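(* Let $U,V\subset\mathbb R^3$ be domains, $(s,t)\subset\mathbb R$ an open interval, $\underline a=\sum_{i=1}^3a_ie_i\in C^1(U,V)$ a diffeomorphism with real-valued components, and $a:(s,t)\times U\to(s,t)\times V$, $a(x)=x_0+\underline a(\underline x)$. Suppose $(s,t)\times V\subset\mathbb H$ is an axially symmetric s-domain and let $f\in C^1((s,t)\times U,\mathbb H)$. 1. If $f\circ a^{-1}\in\mathcal{SR}((s,t)\times V)$, then $\mathcal H_a(f)=0$ on $(s,t)\times U$. 2. If $f\circ a^{-1}\in\mathcal{HR}((s,t)\times V)$, then $\mathcal H_a(f)=0$ on $(s,t)\times U$.
   Context: $\mathbb H$ is the skew-field of quaternions with imaginary units $e_1,e_2,e_3$; $x=x_0+\underline x$ with $\underline x=\sum_{k=1}^3x_ke_k$, and $\mathbb R\times\mathbb R^3$ is identified with $\mathbb H$. $\mathbb S^2$ is the unit sphere of purely imaginary quaternions; for $I\in\mathbb S^2$, $\mathbb C_I=\mathbb R+I\mathbb R$. "Diffeomorphism" means a $C^1$ bijection with $C^1$ inverse; $a^{-1}(y)=y_0+\sum_{j=1}^3(a^{-1})_j(\underline y)e_j$, with $(a^{-1})_j$ the $j$-th real component of $(\underline a)^{-1}$. Operator: $$\mathcal H_a(f)=\underline a\frac{\partial f}{\partial x_0}-\sum_{i=1}^3\Big(\sum_{j=1}^3a_j\Big(\frac{\partial(a^{-1})_i}{\partial y_j}\circ a\Big)\Big)\frac{\partial f}{\partial x_i}.$$ A domain $W\subset\mathbb H$ is an s-domain if $W\cap\mathbb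 R\ne\emptyset$ and $W\cap\mathbb C_I$ is a domain in $\mathbb C_I$ for all $I\in\mathbb S^2$; $W$ is axially symmetric if $u+Iv\in W$ implies $u+Jv\in W$ for all $J\in\mathbb S^2$. $\mathcal{SR}(W)$: real differentiable $h:W\to\mathbb H$ with $\big(\frac{\partial}{\partial u}+I\frac{\partial}{\partial v}\big)h|_{W\cap\mathbb C_I}(u+Iv)=0$ on $W\cap\mathbb C_I$ for every $I\in\mathbb S^2$. $\mathcal{HR}(W)$ ($W$ axially symmetric open): functions $h(u+Iv)=\alpha(u,v)+I\beta(u,v)$ for all $u+Iv\in W$, $I\in\mathbb S^2$, with $\alpha,\beta$ differentiable $\mathbb H$-valued functions on $\{(u,v)\in\mathbb R^2:u+Iv\in W\}$, $\alpha(u,v)=\alpha(u,-v)$, $\beta(u,v)=-\beta(u,-v)$, $\frac{\partial\alpha}{\partial u}-\frac{\partial\beta}{\partial v}=0$, $\frac{\partial\alpha}{\partial v}+\frac{\partial\beta}{\partial u}=0$. *)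

theory Defs
  imports "HOL-Analysis.Analysis"
begin

section \<open>Quaternions\<close>

text \<open>
  The quaternion \<open>x\<^sub>0 + x\<^sub>1 e\<^sub>1 + x\<^sub>2 e\<^sub>2 + x\<^sub>3 e\<^sub>3\<close> is the pair \<open>(x\<^sub>0, (x\<^sub>1, x\<^sub>2, x\<^sub>3))\<close>.  Addition, real
  scaling, norm and topology are those of the product type; only the Hamilton product is new.
  (The type \<^typ>\<open>real ^ 3\<close> carries a componentwise product \<open>*\<close>, which is never meant here.)
\<close>

type_synonym quat = "real \<times> (real ^ 3)"

definition quat_mult :: "quat \<Rightarrow> quat \<Rightarrow> quat"  (infixl \<open>*\<^sub>H\<close> 70) where
  "p *\<^sub>H q = (fst p * fst q - snd p \<bullet> snd q,
              fst p *\<^sub>R snd q + fst q *\<^sub>R snd p + cross3 (snd p) (snd q))"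

definition quat_one :: quat where
  "quat_one = (1, 0)"

definition quat_vec :: "real ^ 3 \<Rightarrow> quat" where
  "quat_vec y = (0, y)"

definition quat_unit :: "3 \<Rightarrow> quat" where
  "quat_unit k = quat_vec (axis k 1)"

lemma quat_unit_squares:
  "quat_unit k *\<^sub>H quat_unit k = - quat_one"
  by (simp add: quat_unit_def quat_vec_def quat_mult_def quat_one_def cross_refl inner_axis_axis)

lemma quat_unit_products:
  "quat_unit 1 *\<^sub>H quat_unit 2 = quat_unit 3"
  "quat_unit 2 *\<^sub>H quat_unit 3 = quat_unit 1"
  "quat_unit 3 *\<^sub>H quat_unit 1 = quat_unit 2"
  "quat_unit 2 *\<^sub>H quat_unit 1 = - quat_unit 3"
  "quat_unit 3 *\<^sub>H quat_unit 2 = - quat_unit 1"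
  "quat_unit 1 *\<^sub>H quat_unit 3 = - quat_unit 2"
  by (simp_all add: quat_unit_def quat_vec_def quat_mult_def cross3_def axis_def inner_vec_def
      sum_3 vec_eq_iff forall_3)

lemma quat_one_mult: "quat_one *\<^sub>H q = q" "q *\<^sub>H quat_one = q"
  by (simp_all add: quat_mult_def quat_one_def cross_zero_left cross_zero_right)

lemma quat_mult_assoc: "(p *\<^sub>H q) *\<^sub>H r = p *\<^sub>H (q *\<^sub>H r)"
  by (simp add: quat_mult_def cross3_def inner_vec_def sum_3 vec_eq_iff forall_3 algebra_simps)

lemma bilinear_quat_mult: "bilinear (*\<^sub>H)"
  unfolding bilinear_def
  by (auto intro!: linearI simp: quat_mult_def cross3_def inner_vec_def sum_3 vec_eq_iff forall_3
      algebra_simps)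

lemma quat_right_inverse:
  assumes "q \<noteq> 0"
  shows "q *\<^sub>H ((1 / (norm q)\<^sup>2) *\<^sub>R (fst q, - snd q)) = quat_one"
proof -
  have n: "(norm q)\<^sup>2 = fst q * fst q + snd q \<bullet> snd q"
    by (simp add: power2_norm_eq_inner inner_prod_def)
  have "(norm q)\<^sup>2 \<noteq> 0"
    using assms by simp
  then show ?thesis
    unfolding quat_mult_def quat_one_def n
    by (simp add: cross_mult_right cross_refl add_divide_distrib[symmetric])
qed


section \<open>Domains, partial derivatives, \<open>C\<^sup>1\<close> maps\<close>

definition domain_in :: "'a::topological_space set \<Rightarrow> 'a set \<Rightarrow> bool" where
  "domain_in X S \<longleftrightarrow> openin (top_of_set X) S \<and> connected S \<and> S \<noteq> {}"

text \<open>\<open>partial e f x\<close> is the derivative at \<open>x\<close> of \<open>f\<close> along the coordinate direction \<open>e\<close>.\<close>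

definition partial ::
  "'a::real_normed_vector \<Rightarrow> ('a \<Rightarrow> 'b::real_normed_vector) \<Rightarrow> 'a \<Rightarrow> 'b" where
  "partial e f x = vector_derivative (\<lambda>t. f (x + t *\<^sub>R e)) (at 0)"

text \<open>Meant for open \<open>S\<close>.\<close>

definition C1_on :: "'a::real_normed_vector set \<Rightarrow> ('a \<Rightarrow> 'b::real_normed_vector) \<Rightarrow> bool" where
  "C1_on S f \<longleftrightarrow> (\<exists>f' :: 'a \<Rightarrow> 'a \<Rightarrow>\<^sub>L 'b.
     (\<forall>x\<in>S. (f has_derivative blinfun_apply (f' x)) (at x)) \<and> continuous_on S f')"

definition diffeomorphism ::
  "'a::real_normed_vector set \<Rightarrow> 'b::real_normed_vector set \<Rightarrow> ('a \<Rightarrow> 'b) \<Rightarrow> bool" where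
  "diffeomorphism U V a \<longleftrightarrow> bij_betw a U V \<and> C1_on U a \<and> C1_on V (inv_into U a)"


section \<open>Slices\<close>

definition imag_sphere :: "quat set" where
  "imag_sphere = {I. fst I = 0 \<and> norm I = 1}"

text \<open>\<open>slice_point I (u, v)\<close> is \<open>u + I v\<close>.\<close>

definition slice_point :: "quat \<Rightarrow> real \<times> real \<Rightarrow> quat" where
  "slice_point I w = fst w *\<^sub>R quat_one + snd w *\<^sub>R I"

definition slice_plane :: "quat \<Rightarrow> quat set" where
  "slice_plane I = range (slice_point I)"

definition real_axis :: "quat set" where
  "real_axis = range (\<lambda>u. u *\<^sub>R quat_one)"

definition s_domain :: "quat set \<Rightarrow> bool" where
  "s_domain W \<longleftrightarrow> domain_in UNIV W \<and> W \<inter> real_axis \<noteq> {} \<and>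
     (\<forall>I\<in>imag_sphere. domain_in (slice_plane I) (W \<inter> slice_plane I))"

definition axially_symmetric :: "quat set \<Rightarrow> bool" where
  "axially_symmetric W \<longleftrightarrow> (\<forall>w. \<forall>I\<in>imag_sphere. \<forall>J\<in>imag_sphere.
     slice_point I w \<in> W \<longrightarrow> slice_point J w \<in> W)"


section \<open>Slice regular functions\<close>

text \<open>
  Functions on an open set \<open>W\<close> are total functions of which only the values on \<open>W\<close> matter.
\<close>

definition SR :: "quat set \<Rightarrow> (quat \<Rightarrow> quat) set" where
  "SR W = {h. h differentiable_on W \<and>
     (\<forall>I\<in>imag_sphere. \<forall>w. slice_point I w \<in> W \<longrightarrow>
        partial (1, 0) (\<lambda>w. h (slice_point I w)) w
          + I *\<^sub>H partial (0, 1) (\<lambda>w. h (slice_point I w)) w = 0)}"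

text \<open>
  For axially symmetric \<open>W\<close> the set \<open>{(u, v). u + I v \<in> W}\<close> does not depend on \<open>I\<close>, so quantifying
  \<open>I\<close> existentially in the definition below is immaterial.
\<close>

definition slice_params :: "quat set \<Rightarrow> (real \<times> real) set" where
  "slice_params W = {w. \<exists>I\<in>imag_sphere. slice_point I w \<in> W}"

definition HR :: "quat set \<Rightarrow> (quat \<Rightarrow> quat) set" where
  "HR W = {h. \<exists>\<alpha> \<beta> :: real \<times> real \<Rightarrow> quat.
     \<alpha> differentiable_on slice_params W \<and> \<beta> differentiable_on slice_params W \<and>
     (\<forall>u v. (u, v) \<in> slice_params W \<longrightarrow>
        \<alpha> (u, v) = \<alpha> (u, - v) \<and> \<beta> (u, v) = - \<beta> (u, - v) \<and>
        partial (1, 0) \<alpha> (u, v) - partial (0, 1) \<beta> (u, v) = 0 \<and>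
        partial (0, 1) \<alpha> (u, v) + partial (1, 0) \<beta> (u, v) = 0) \<and>
     (\<forall>I\<in>imag_sphere. \<forall>w. slice_point I w \<in> W \<longrightarrow>
        h (slice_point I w) = \<alpha> w + I *\<^sub>H \<beta> w)}"


section \<open>The operator\<close>

text \<open>The map \<open>x \<mapsto> x\<^sub>0 + b(x\<^sub>1, x\<^sub>2, x\<^sub>3)\<close> induced by \<open>b\<close> on the vector parts.\<close>

definition lift_vec :: "(real ^ 3 \<Rightarrow> real ^ 3) \<Rightarrow> quat \<Rightarrow> quat" where
  "lift_vec b x = (fst x, b (snd x))"

text \<open>
  The set \<open>U\<close> is an argument only because it determines the inverse \<open>inv_into U a : V \<rightarrow> U\<close>.
\<close>

definition H_op ::
  "(real ^ 3) set \<Rightarrow> (real ^ 3 \<Rightarrow> real ^ 3) \<Rightarrow> (quat \<Rightarrow> quat) \<Rightarrow> quat \<Rightarrow> quat" where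
  "H_op U a f x =
     quat_vec (a (snd x)) *\<^sub>H partial quat_one f x
     - (\<Sum>i\<in>UNIV. (\<Sum>j\<in>UNIV. a (snd x) $ j *
           partial (axis j 1) (\<lambda>y. inv_into U a y $ i) (a (snd x)))
         *\<^sub>R partial (quat_unit i) f x)"

end

theory Submission
  imports Defs
begin

text \<open>
  Put \<open>h = f \<circ> a\<^sup>-\<^sup>1\<close>, \<open>v = a(x)\<close> and \<open>y = x\<^sub>0 + v\<close>.  By the chain rule the operator is
  \<open>H\<^sub>a f (x) = v Dh(y)(1) - Dh(y)(v)\<close>.  Writing \<open>v = r I\<close> with \<open>I\<close> an imaginary unit, this equals
  \<open>r I (Dh(y)(1) + I Dh(y)(I))\<close>, and the bracket is the Cauchy-Riemann operator on the slice of \<open>I\<close>.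
\<close>

text \<open>On the line through \<open>x\<close> in direction \<open>e\<close> the chain rule gives
  velocity \<open>D e\<close>. This turns every partial derivative in the definitions into a value
  of a total derivative.\<close>

lemma partial_eq_derivative:
  assumes "(f has_derivative D) (at x)"
  shows "partial e f x = D e"
proof -
  have "((\<lambda>t. f (x + t *\<^sub>R e)) has_derivative (\<lambda>t. D (t *\<^sub>R e))) (at 0)"
    by (rule has_derivative_compose[where g = f]) (auto intro!: derivative_eq_intros simp: assms)
  moreover have "(\<lambda>t. D (t *\<^sub>R e)) = (\<lambda>t. t *\<^sub>R D e)"
    using assms by (simp add: has_derivative_bounded_linear linear_simps(5))
  ultimately show ?thesis
    unfolding partial_def by (simp add: has_vector_derivative_def vector_derivative_at)
qed

lemma bounded_bilinear_quat_mult: "bounded_bilinear (*\<^sub>H)"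
  using bilinear_quat_mult bilinear_conv_bounded_bilinear by blast

lemma imag_sphere_square: "I \<in> imag_sphere \<Longrightarrow> I *\<^sub>H I = - quat_one"
  by (auto simp: imag_sphere_def quat_mult_def quat_one_def norm_prod_def
      power2_norm_eq_inner[symmetric] cross_refl)

lemma bounded_linear_slice_point: "bounded_linear (slice_point I)"
  unfolding slice_point_def
  by (intro bounded_linear_add bounded_linear_compose[OF bounded_linear_scaleR_left]
      bounded_linear_fst bounded_linear_snd)

lemma slice_point_coords [simp]:
  "slice_point I (1, 0) = quat_one" "slice_point I (0, 1) = I"
  by (simp_all add: slice_point_def)

text \<open>Polar form of the vector part, with \<open>r = norm v\<close> and \<open>I\<close> the
  direction of \<open>v\<close>. For \<open>v = 0\<close> any unit serves, since
  \<open>r = 0\<close>, so real points need no separate treatment later.\<close>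

lemma quat_slice_decomposition:
  obtains r I where "I \<in> imag_sphere" "(c, v) = slice_point I (c, r)" "quat_vec v = r *\<^sub>R I"
proof -
  obtain n :: "real ^ 3" where n: "norm n = 1" "v = norm v *\<^sub>R n"
  proof (cases "v = 0")
    case True
    then show ?thesis
      using that[of "axis 1 1"] by simp
  next
    case False
    then show ?thesis
      using that[of "v /\<^sub>R norm v"] by simp
  qed
  show ?thesis
    by (rule that[of "(0, n)" "norm v"])
      (use n in \<open>auto simp: imag_sphere_def slice_point_def quat_one_def quat_vec_def norm_Pair\<close>)
qed

lemma has_derivative_slice:
  assumes "(h has_derivative D) (at (slice_point I w))"
  shows "((\<lambda>w. h (slice_point I w)) has_derivative (\<lambda>d. D (slice_point I d))) (at w)"
  by (rule has_derivative_compose[where g = h])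
    (auto simp: assms bounded_linear_slice_point bounded_linear_imp_has_derivative)

text \<open>The restriction of \<open>h\<close> to the slice has derivative \<open>D\<close>
  composed with \<open>slice_point I\<close>, so its partials in u and v are
  \<open>D quat_one\<close> and \<open>D I\<close>.\<close>

lemma SR_slice_derivative:
  assumes "h \<in> SR W" "I \<in> imag_sphere" "slice_point I w \<in> W"
    and "(h has_derivative D) (at (slice_point I w))"
  shows "D quat_one + I *\<^sub>H D I = 0"
proof -
  have "partial (1, 0) (\<lambda>w. h (slice_point I w)) w
      + I *\<^sub>H partial (0, 1) (\<lambda>w. h (slice_point I w)) w = 0"
    using assms(1-3) unfolding SR_def by blast
  then show ?thesis
    by (simp add: partial_eq_derivative[OF has_derivative_slice[OF assms(4)]])
qed

lemma open_vimage_slice_point: "open W \<Longrightarrow> open (slice_point I -` W)"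
  by (simp add: bounded_linear_slice_point linear_continuous_on open_vimage)

text \<open>Openness makes differentiability of \<alpha> and \<beta> on the parameter set the same
  as differentiability at each of its points.\<close>

lemma open_slice_params:
  assumes "open W"
  shows "open (slice_params W)"
proof -
  have "slice_params W = (\<Union>I\<in>imag_sphere. slice_point I -` W)"
    unfolding slice_params_def by blast
  then show ?thesis
    using open_vimage_slice_point[OF assms] by auto
qed

text \<open>Differentiating h = \<alpha> + I \<beta> along the slice expresses
  \<open>D quat_one\<close> and \<open>D I\<close> through the partials of \<alpha> and \<beta>. The
  Cauchy-Riemann equations for this pair and I I = -1 then cancel all terms.\<close>

lemma HR_slice_derivative:
  assumes "open W" "h \<in> HR W" "I \<in> imag_sphere" "slice_point I w \<in> W"
    and D: "(h has_derivative D) (at (slice_point I w))"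
  shows "D quat_one + I *\<^sub>H D I = 0"
proof -
  interpret bounded_bilinear "(*\<^sub>H)"
    by (rule bounded_bilinear_quat_mult)
  obtain \<alpha> \<beta> :: "real \<times> real \<Rightarrow> quat" where
    diff: "\<alpha> differentiable_on slice_params W" "\<beta> differentiable_on slice_params W"
    and CR: "\<And>u v. (u, v) \<in> slice_params W \<Longrightarrow>
        partial (1, 0) \<alpha> (u, v) - partial (0, 1) \<beta> (u, v) = 0 \<and>
        partial (0, 1) \<alpha> (u, v) + partial (1, 0) \<beta> (u, v) = 0"
    and h: "\<And>w. slice_point I w \<in> W \<Longrightarrow> h (slice_point I w) = \<alpha> w + I *\<^sub>H \<beta> w"
    using assms(2,3) unfolding HR_def by blast
  have w: "w \<in> slice_params W"
    using assms(3,4) unfolding slice_params_def by blast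
  then obtain A B where AB: "(\<alpha> has_derivative A) (at w)" "(\<beta> has_derivative B) (at w)"
    using diff open_slice_params[OF \<open>open W\<close>]
    by (metis at_within_open differentiable_def differentiable_on_def)
  have "((\<lambda>w. \<alpha> w + I *\<^sub>H \<beta> w) has_derivative (\<lambda>d. A d + I *\<^sub>H B d)) (at w)"
    by (intro has_derivative_add AB bounded_linear.has_derivative[OF bounded_linear_right])
  \<comment> \<open>The representation of \<open>h\<close> holds only at parameters whose slice
    point lies in \<open>W\<close>; these form an open neighbourhood of \<open>w\<close>, which
    suffices for the derivative.\<close>
  then have "((\<lambda>w. h (slice_point I w)) has_derivative (\<lambda>d. A d + I *\<^sub>H B d)) (at w)"
    by (rule has_derivative_transform_within_open[OF _ open_vimage_slice_point[OF \<open>open W\<close>]])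
      (use assms(4) h in auto)
  then have eq: "(\<lambda>d. D (slice_point I d)) = (\<lambda>d. A d + I *\<^sub>H B d)"
    using has_derivative_slice[OF D] has_derivative_unique by blast
  have "D quat_one = A (1, 0) + I *\<^sub>H B (1, 0)" "D I = A (0, 1) + I *\<^sub>H B (0, 1)"
    using fun_cong[OF eq, of "(1, 0)"] fun_cong[OF eq, of "(0, 1)"] by simp_all
  moreover have "A (1, 0) = B (0, 1)" "A (0, 1) = - B (1, 0)"
    using CR[of "fst w" "snd w"] w AB by (auto simp: partial_eq_derivative add_eq_0_iff2)
  moreover have "I *\<^sub>H (I *\<^sub>H q) = - q" for q
    using assms(3)
    by (simp add: quat_mult_assoc[symmetric] imag_sphere_square minus_left quat_one_mult)
  ultimately show ?thesis
    by (simp add: add_right diff_right)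
qed

text \<open>With v = a(x), the inner sum over j in the operator is the derivative of the i-th
  component of the inverse along v. The outer sum is therefore the derivative of f along
  \<open>B\<close> v, which is \<open>D\<close> at the vector quaternion v.\<close>

lemma H_op_chain_rule:
  assumes b: "(inv_into U a has_derivative B) (at (a (snd x)))"
    and inv: "inv_into U a (a (snd x)) = snd x"
    and f: "(f has_derivative F) (at x)"
  defines "D \<equiv> \<lambda>d. F (fst d, B (snd d))" and "y \<equiv> (fst x, a (snd x))"
  shows "(f \<circ> lift_vec (inv_into U a) has_derivative D) (at y)"
    and "H_op U a f x = quat_vec (a (snd x)) *\<^sub>H D quat_one - D (quat_vec (a (snd x)))"
proof -
  interpret F: linear F
    using f by (rule has_derivative_linear)
  interpret B: linear B
    using b by (rule has_derivative_linear)
  have "((\<lambda>z. inv_into U a (snd z)) has_derivative (\<lambda>d. B (snd d))) (at y)"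
    by (rule has_derivative_compose[where f = snd]) (auto intro!: derivative_eq_intros simp: y_def b)
  then have "(lift_vec (inv_into U a) has_derivative (\<lambda>d. (fst d, B (snd d)))) (at y)"
    unfolding lift_vec_def by (auto intro!: derivative_eq_intros)
  moreover have "lift_vec (inv_into U a) y = x"
    by (simp add: lift_vec_def y_def inv)
  ultimately show "(f \<circ> lift_vec (inv_into U a) has_derivative D) (at y)"
    using f has_derivative_compose[of "lift_vec (inv_into U a)" _ y UNIV f F]
    by (simp add: D_def comp_def)

  let ?v = "a (snd x)"
  have p: "partial (axis j 1) (\<lambda>z. inv_into U a z $ i) ?v = B (axis j 1) $ i" for i j
    by (rule partial_eq_derivative)
      (rule bounded_linear.has_derivative[OF bounded_linear_vec_nth b])
  \<comment> \<open>Linearity of \<open>B\<close> applied to the expansion of v in the standard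
    basis.\<close>
  have "(\<Sum>j\<in>UNIV. ?v $ j * B (axis j 1) $ i) = B ?v $ i" for i
  proof -
    have "B ?v = B (\<Sum>j\<in>UNIV. ?v $ j *\<^sub>R axis j 1)"
      by (simp add: basis_expansion flip: scalar_mult_eq_scaleR)
    then show ?thesis
      by (simp add: B.sum B.scaleR)
  qed
  \<comment> \<open>The same expansion for \<open>F\<close>; it is used with u = \<open>B\<close>
    v.\<close>
  moreover have "(\<Sum>i\<in>UNIV. (u $ i) *\<^sub>R F (quat_unit i)) = F (quat_vec u)" for u
  proof -
    have "quat_vec u = quat_vec (\<Sum>i\<in>UNIV. u $ i *\<^sub>R axis i 1)"
      by (simp add: basis_expansion flip: scalar_mult_eq_scaleR)
    also have "\<dots> = (\<Sum>i\<in>UNIV. (u $ i) *\<^sub>R quat_unit i)"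
      by (simp add: quat_vec_def quat_unit_def prod_eq_iff fst_sum snd_sum)
    finally show ?thesis
      by (simp add: F.sum F.scaleR)
  qed
  \<comment> \<open>The first terms agree because \<open>B\<close> 0 = 0 gives
    \<open>D quat_one = F quat_one\<close>.\<close>
  ultimately show "H_op U a f x = quat_vec ?v *\<^sub>H D quat_one - D (quat_vec ?v)"
    unfolding H_op_def partial_eq_derivative[OF f] p
    by (simp add: D_def quat_one_def quat_vec_def B.zero)
qed

text \<open>The argument shared by both function classes: each enters only through the
  Cauchy-Riemann identity \<open>CR\<close> for the total derivative on a slice. That derivative
  exists because f and the inverse of a are C1.\<close>

lemma H_op_eq_0:
  assumes "diffeomorphism U V a" "C1_on (T \<times> U) f" "x \<in> T \<times> U"
    and CR: "\<And>I w D. I \<in> imag_sphere \<Longrightarrow> slice_point I w \<in> T \<times> V \<Longrightarrow>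
        (f \<circ> lift_vec (inv_into U a) has_derivative D) (at (slice_point I w)) \<Longrightarrow>
        D quat_one + I *\<^sub>H D I = 0"
  shows "H_op U a f x = 0"
proof -
  interpret bounded_bilinear "(*\<^sub>H)"
    by (rule bounded_bilinear_quat_mult)
  let ?v = "a (snd x)"
  have x: "fst x \<in> T" "snd x \<in> U"
    using assms(3) by auto
  then have v: "?v \<in> V" "inv_into U a ?v = snd x"
    using assms(1) by (auto simp: diffeomorphism_def bij_betw_def)
  obtain B where B: "(inv_into U a has_derivative B) (at ?v)"
    using assms(1) v(1) unfolding diffeomorphism_def C1_on_def by blast
  obtain F where F: "(f has_derivative F) (at x)"
    using assms(2,3) unfolding C1_on_def by blast
  define D where "D d = F (fst d, B (snd d))" for d
  have D: "(f \<circ> lift_vec (inv_into U a) has_derivative D) (at (fst x, ?v))"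
    and H: "H_op U a f x = quat_vec ?v *\<^sub>H D quat_one - D (quat_vec ?v)"
    using H_op_chain_rule[OF B v(2) F] by (simp_all add: D_def[abs_def])
  obtain r I where I: "I \<in> imag_sphere" "(fst x, ?v) = slice_point I (fst x, r)"
      "quat_vec ?v = r *\<^sub>R I"
    by (rule quat_slice_decomposition)
  have "D quat_one + I *\<^sub>H D I = 0"
    by (rule CR[OF I(1), of "(fst x, r)"]) (use D x(1) v(1) in \<open>simp_all flip: I(2)\<close>)
  \<comment> \<open>Multiplying the identity by \<open>I\<close> from the left gives
    \<open>I *\<^sub>H D quat_one = D I\<close>. Scaling by \<open>r\<close> turns this into
    equality of the two terms of the operator.\<close>
  then have "I *\<^sub>H D quat_one = - (I *\<^sub>H (I *\<^sub>H D I))"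
    by (metis add_right eq_neg_iff_add_eq_0 zero_right)
  also have "\<dots> = D I"
    using I(1) by (simp add: quat_mult_assoc[symmetric] imag_sphere_square minus_left quat_one_mult)
  finally show ?thesis
    using H I(3) linear_scale[OF has_derivative_linear[OF D]] by (simp add: scaleR_left)
qed

theorem theorem3p19:
  fixes U V :: "(real ^ 3) set"
    and s t :: ereal
    and a :: "real ^ 3 \<Rightarrow> real ^ 3"
    and f :: "quat \<Rightarrow> quat"
  assumes "domain_in UNIV U" and "domain_in UNIV V"
    and "s < t"
    and "diffeomorphism U V a"
    and "s_domain (einterval s t \<times> V)"
    and "axially_symmetric (einterval s t \<times> V)"
    and "C1_on (einterval s t \<times> U) f"
  shows "(f \<circ> lift_vec (inv_into U a) \<in> SR (einterval s t \<times> V)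
            \<longrightarrow> (\<forall>x \<in> einterval s t \<times> U. H_op U a f x = 0))
       \<and> (f \<circ> lift_vec (inv_into U a) \<in> HR (einterval s t \<times> V)
            \<longrightarrow> (\<forall>x \<in> einterval s t \<times> U. H_op U a f x = 0))"
proof (intro conjI impI ballI)
  fix x
  assume x: "x \<in> einterval s t \<times> U"
  show "H_op U a f x = 0" if "f \<circ> lift_vec (inv_into U a) \<in> SR (einterval s t \<times> V)"
    by (rule H_op_eq_0[OF assms(4,7) x]) (rule SR_slice_derivative[OF that])
  \<comment> \<open>The slice identity for \<open>HR\<close> requires an open set; openness is part
    of being an s-domain.\<close>
  have "open (einterval s t \<times> V)"
    using assms(5) by (simp add: s_domain_def domain_in_def)
  then show "H_op U a f x = 0" if "f \<circ> lift_vec (inv_into U a) \<in> HR (einterval s t \<times> V)"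
    using that by (intro H_op_eq_0[OF assms(4,7) x]) (rule HR_slice_derivative)
qed

end
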